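(* Let $(\bar u,\bar\lambda)\in X\times\bar\Lambda$ be the unique solution of $$a(\bar u,v)+\langle\bar\lambda,v\rangle_{X',X}=(f,v)_X\ \text{ for all } v\in X,\qquad \langle\bar\mu-\bar\lambda,\bar u\rangle_{X',X}\le 0\ \text{ for all }\bar\mu\in\bar\Lambda,$$ let $\widetilde\lambda\in Y$ be the unique element of $Y$ such that $B^t\widetilde\lambda=\bar\lambda$, and let $(u,\lambda)\in X\times\Lambda$ be the unique solution of $$a(u,v)+\langle\lambda,\gamma v\rangle_{Y,M}=(f,v)_X\ \text{ for all } v\in X,\qquad \langle\mu-\lambda,\gamma u\rangle_{Y,M}\le 0\ \text{ for all }\mu\in\Lambda.$$ Then $\bar u=u$ and $\widetilde\lambda=\lambda$.
   Context: $\Omega\subset\mathbb R^2$ is a bounded domain with smooth boundary $\Gamma$, partitioned into three measurable parts $\Gamma_1,\Gamma_2,\Gamma_3$ of positive measure. $g>0$ and $\xi>0$ are constants, $f_0\in L^2(\Omega)$, $f_2\in L^2(\Gamma_2)$. $\gamma:H^1(\Omega)\to L^2(\Gamma)$ is the trace operator, with range $H^{1/2}(\Gamma)$. $X=\{v\in H^1(\Omega)\mid \gamma v=0 \text{ a.e. on }\Gamma_1\}$ is the Hilbert space with inner product $(u,v)_X=(\nabla u,\nabla v)_{L^2(\Omega)^2}$; $X'$ is its dual and $\langle\cdot,\cdot\rangle_{X',X}$ the duality pairing. $M=\gamma(X)\subset H^{1/2}(\Gamma)$, a Hilbert space as a subspace of $H^{1/2}(\Gamma)$; $Y=M'$ is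 its dual, with duality pairing $\langle\cdot,\cdot\rangle_{Y,M}$. $a:X\times X\to\mathbb R$, $a(u,v)=\xi(u,v)_X$; $f\in X$ is the element defined (via the Riesz representation theorem) by $(f,v)_X=\int_\Omega f_0v\,dx+\int_{\Gamma_2}f_2\,\gamma v\,d\Gamma$ for all $v\in X$. $\Lambda=\{\mu\in Y\mid\langle\mu,\gamma v\rangle_{Y,M}\le\int_{\Gamma_3}g|\gamma v|\,d\Gamma\ \text{ for all }v\in X\}$ and $\bar\Lambda=\{\bar\mu\in X'\mid \langle\bar\mu,v\rangle_{X',X}\le\int_{\Gamma_3}g|\gamma v|\,d\Gamma\ \text{ for all }v\in X\}$. $B^t:Y\to X'$ is the continuous linear operator defined by $\langle B^t\mu,v\rangle_{X',X}=\langle\mu,\gamma v\rangle_{Y,M}$ for all $\mu\in Y$, $v\in X$. Both mixed problems in the statement are known to have a unique solution, and there is a unique $\widetilde\lambda\in Y$ with $B^t\widetilde\lambda=\bar\lambda$. *)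

theory Defs
  imports "HOL-Analysis.Analysis"
begin

section \<open>Smooth functions and smooth domains in the plane\<close>

definition pderiv_at :: "2 \<Rightarrow> (real^2 \<Rightarrow> real) \<Rightarrow> real^2 \<Rightarrow> real" where
  "pderiv_at i f x = frechet_derivative f (at x) (axis i 1)"

text \<open>Only meant for open \<open>U\<close>.\<close>

primrec Ck_on :: "nat \<Rightarrow> (real^2) set \<Rightarrow> (real^2 \<Rightarrow> real) \<Rightarrow> bool" where
  "Ck_on 0 U f \<longleftrightarrow> continuous_on U f"
| "Ck_on (Suc k) U f \<longleftrightarrow> f differentiable_on U \<and> (\<forall>i. Ck_on k U (pderiv_at i f))"

definition smooth_on :: "(real^2) set \<Rightarrow> (real^2 \<Rightarrow> real) \<Rightarrow> bool" where
  "smooth_on U f \<longleftrightarrow> (\<forall>k. Ck_on k U f)"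

text \<open>
  Near each boundary point, \<open>\<Omega>\<close> is a strict sublevel set of a smooth function without critical
  points. Hence the boundary is locally a smooth curve with \<open>\<Omega>\<close> on one side of it only.
\<close>

definition smooth_boundary :: "(real^2) set \<Rightarrow> bool" where
  "smooth_boundary \<Omega> \<longleftrightarrow> (\<forall>p\<in>frontier \<Omega>. \<exists>U \<phi>. open U \<and> p \<in> U \<and> smooth_on U \<phi> \<and>
     (\<forall>x\<in>U. \<exists>i. pderiv_at i \<phi> x \<noteq> 0) \<and> \<Omega> \<inter> U = {x \<in> U. \<phi> x < 0})"

definition smooth_bounded_domain :: "(real^2) set \<Rightarrow> bool" where
  "smooth_bounded_domain \<Omega> \<longleftrightarrow>
     open \<Omega> \<and> connected \<Omega> \<and> \<Omega> \<noteq> {} \<and> bounded \<Omega> \<and> smooth_boundary \<Omega>"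

section \<open>Surface measure\<close>

text \<open>
  The surface (arc length) measure is the one-dimensional Hausdorff measure on the
  Caratheodory-measurable sets. In dimension one the normalising constant is 1.
\<close>

definition hausdorff1_outer :: "(real^2) set \<Rightarrow> ennreal" where
  "hausdorff1_outer A =
     (SUP \<delta>\<in>{0<..}. INF C\<in>{C :: nat \<Rightarrow> (real^2) set.
         A \<subseteq> (\<Union>i. C i) \<and> (\<forall>i. bounded (C i) \<and> diameter (C i) \<le> \<delta>)}.
       (\<Sum>i. ennreal (diameter (C i))))"

definition hausdorff1 :: "(real^2) measure" where
  "hausdorff1 = measure_of UNIV (lambda_system UNIV UNIV hausdorff1_outer) hausdorff1_outer"

definition surface_measure :: "(real^2) set \<Rightarrow> (real^2) measure" where
  "surface_measure A = restrict_space hausdorff1 A"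

lemma outer_measure_space_hausdorff1_outer: "outer_measure_space UNIV hausdorff1_outer"
proof -
  define I where "I \<delta> A = (INF C\<in>{C :: nat \<Rightarrow> (real^2) set.
         A \<subseteq> (\<Union>i. C i) \<and> (\<forall>i. bounded (C i) \<and> diameter (C i) \<le> \<delta>)}.
       (\<Sum>i. ennreal (diameter (C i))))" for \<delta> A
  have H: "hausdorff1_outer A = (SUP \<delta>\<in>{0<..}. I \<delta> A)" for A
    by (simp add: hausdorff1_outer_def I_def)
  have I_empty: "I \<delta> {} = 0" if "\<delta> > 0" for \<delta>
  proof -
    have "I \<delta> {} \<le> (\<Sum>i::nat. ennreal (diameter ({}::(real^2) set)))"
      unfolding I_def by (rule INF_lower2[of "\<lambda>_. {}"]) (use that in auto)
    then show ?thesis by simp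
  qed
  have I_mono: "I \<delta> A \<le> I \<delta> B" if "A \<subseteq> B" for \<delta> A B
    unfolding I_def by (rule INF_superset_mono) (use that in auto)
  have I_csub: "I \<delta> (\<Union>n. A n) \<le> (\<Sum>n. I \<delta> (A n))" for \<delta> and A :: "nat \<Rightarrow> (real^2) set"
  proof (rule ennreal_le_epsilon)
    fix e :: real
    assume fin: "(\<Sum>n. I \<delta> (A n)) < top" and e: "0 < e"
    have lt: "I \<delta> (A n) < I \<delta> (A n) + ennreal (e * (1/2)^Suc n)" for n
    proof -
      have "I \<delta> (A n) \<noteq> top"
        using fin ennreal_suminf_lessD[of "\<lambda>n. I \<delta> (A n)" top n] by auto
      then show ?thesis
        using e by (cases "I \<delta> (A n)") (auto simp: ennreal_plus[symmetric] ennreal_less_iff simp del: ennreal_plus)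
    qed
    have "\<exists>C. A n \<subseteq> (\<Union>i. C i) \<and> (\<forall>i::nat. bounded (C i) \<and> diameter (C i) \<le> \<delta>) \<and>
        (\<Sum>i. ennreal (diameter (C i))) < I \<delta> (A n) + ennreal (e * (1/2)^Suc n)" for n
      using lt[of n] unfolding I_def INF_less_iff by auto
    then obtain C where C: "\<And>n. A n \<subseteq> (\<Union>i. C n i)"
        "\<And>n i::nat. bounded (C n i) \<and> diameter (C n i) \<le> \<delta>"
        "\<And>n. (\<Sum>i. ennreal (diameter (C n i))) < I \<delta> (A n) + ennreal (e * (1/2)^Suc n)"
      by metis
    define D where "D k = (case prod_decode k of (n, i) \<Rightarrow> C n i)" for k
    have D: "D (prod_encode (n, i)) = C n i" for n i
      by (simp add: D_def)
    have "I \<delta> (\<Union>n. A n) \<le> (\<Sum>k. ennreal (diameter (D k)))"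
      unfolding I_def
    proof (rule INF_lower, safe)
      fix x n assume "x \<in> A n"
      then obtain i where "x \<in> C n i" using C(1) by blast
      then show "x \<in> (\<Union>k. D k)" using D by blast
    next
      fix k show "bounded (D k)" "diameter (D k) \<le> \<delta>"
        using C(2) by (auto simp: D_def split: prod.split)
    qed
    also have "\<dots> = (\<Sum>n. \<Sum>i. ennreal (diameter (C n i)))"
      by (subst suminf_ennreal_2dimen[where f = "\<lambda>(n, i). ennreal (diameter (C n i))", symmetric])
         (auto simp: D_def intro!: suminf_cong split: prod.split)
    also have "\<dots> \<le> (\<Sum>n. I \<delta> (A n) + ennreal (e * (1/2)^Suc n))"
      using C(3) by (intro suminf_le) (auto intro: less_imp_le)
    also have "\<dots> = (\<Sum>n. I \<delta> (A n)) + (\<Sum>n. ennreal (e * (1/2)^Suc n))"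
      by (subst suminf_add) auto
    also have "(\<Sum>n. ennreal (e * (1/2)^Suc n)) = ennreal e"
    proof -
      have "(\<lambda>n. e * (1/2)^Suc n) sums (e * 1)"
        by (intro sums_mult power_half_series)
      then show ?thesis
        using e by (intro sums_unique[symmetric]) (subst sums_ennreal, auto)
    qed
    finally show "I \<delta> (\<Union>n. A n) \<le> (\<Sum>n. I \<delta> (A n)) + ennreal e" .
  qed
  show ?thesis
    unfolding outer_measure_space_def positive_def increasing_def countably_subadditive_def
  proof (intro conjI ballI allI impI)
    show "hausdorff1_outer {} = 0"
      unfolding H using I_empty by (auto intro!: SUP_eq_const)
    show "hausdorff1_outer A \<le> hausdorff1_outer B" if "A \<subseteq> B" for A B
      unfolding H by (rule SUP_subset_mono) (use I_mono that in auto)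
    show "hausdorff1_outer (\<Union>n. A n) \<le> (\<Sum>n. hausdorff1_outer (A n))" for A :: "nat \<Rightarrow> (real^2) set"
      unfolding H
    proof (rule SUP_least)
      fix \<delta> :: real assume "\<delta> \<in> {0<..}"
      then show "I \<delta> (\<Union>n. A n) \<le> (\<Sum>n. SUP \<delta>\<in>{0<..}. I \<delta> (A n))"
        by (intro order_trans[OF I_csub] suminf_le SUP_upper) auto
    qed
  qed
qed

lemma measure_space_hausdorff1:
  "measure_space UNIV (lambda_system UNIV UNIV hausdorff1_outer) hausdorff1_outer"
  using sigma_algebra.caratheodory_lemma[OF sigma_algebra_Pow[of UNIV]]
    outer_measure_space_hausdorff1_outer by simp

lemma space_hausdorff1 [simp]: "space hausdorff1 = UNIV"
  by (simp add: hausdorff1_def)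

lemma sets_hausdorff1: "sets hausdorff1 = lambda_system UNIV UNIV hausdorff1_outer"
  using measure_space_hausdorff1 sigma_algebra.sigma_sets_eq
  by (simp add: hausdorff1_def measure_space_def sets_measure_of_conv) blast

lemma emeasure_hausdorff1: "A \<in> sets hausdorff1 \<Longrightarrow> emeasure hausdorff1 A = hausdorff1_outer A"
  using measure_space_hausdorff1 unfolding hausdorff1_def
  by (intro emeasure_measure_of_sigma) (auto simp: measure_space_def sets_hausdorff1[unfolded hausdorff1_def])

section \<open>Sobolev spaces\<close>

text \<open>
  Elements of the function spaces are represented by functions; equality of elements is equality
  almost everywhere.
\<close>

definition L2 :: "(real^2) measure \<Rightarrow> (real^2 \<Rightarrow> real) set" where
  "L2 N = {f \<in> borel_measurable N. integrable N (\<lambda>x. (f x)\<^sup>2)}"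

definition test_functions :: "(real^2) set \<Rightarrow> (real^2 \<Rightarrow> real) set" where
  "test_functions \<Omega> = {\<phi>. smooth_on UNIV \<phi> \<and> compact (closure {x. \<phi> x \<noteq> 0}) \<and>
     closure {x. \<phi> x \<noteq> 0} \<subseteq> \<Omega>}"

definition has_weak_gradient :: "(real^2) set \<Rightarrow> (real^2 \<Rightarrow> real) \<Rightarrow> (real^2 \<Rightarrow> real^2) \<Rightarrow> bool" where
  "has_weak_gradient \<Omega> v G \<longleftrightarrow> (\<forall>i. (\<lambda>x. G x $ i) \<in> L2 (lebesgue_on \<Omega>) \<and>
     (\<forall>\<phi>\<in>test_functions \<Omega>. (LINT x|lebesgue_on \<Omega>. v x * pderiv_at i \<phi> x) =
        - (LINT x|lebesgue_on \<Omega>. G x $ i * \<phi> x)))"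

definition H1 :: "(real^2) set \<Rightarrow> (real^2 \<Rightarrow> real) set" where
  "H1 \<Omega> = {v \<in> L2 (lebesgue_on \<Omega>). \<exists>G. has_weak_gradient \<Omega> v G}"

text \<open>The weak gradient is unique up to a null set; only integrals of it are used below.\<close>

definition weak_grad :: "(real^2) set \<Rightarrow> (real^2 \<Rightarrow> real) \<Rightarrow> real^2 \<Rightarrow> real^2" where
  "weak_grad \<Omega> v = (SOME G. has_weak_gradient \<Omega> v G)"

definition grad_inner :: "(real^2) set \<Rightarrow> (real^2 \<Rightarrow> real) \<Rightarrow> (real^2 \<Rightarrow> real) \<Rightarrow> real" where
  "grad_inner \<Omega> u v = (LINT x|lebesgue_on \<Omega>. weak_grad \<Omega> u x \<bullet> weak_grad \<Omega> v x)"

definition H1_norm :: "(real^2) set \<Rightarrow> (real^2 \<Rightarrow> real) \<Rightarrow> real" where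
  "H1_norm \<Omega> v = sqrt ((LINT x|lebesgue_on \<Omega>. (v x)\<^sup>2) + grad_inner \<Omega> v v)"

text \<open>
  The Gagliardo (Sobolev-Slobodeckij) form: the boundary has dimension 1 and the order is 1/2, so
  the exponent of the distance in the denominator is 1 + 2 * (1/2) = 2.
\<close>

definition gagliardo :: "(real^2) set \<Rightarrow> (real^2 \<Rightarrow> real) \<Rightarrow> ennreal" where
  "gagliardo \<Gamma> w = (\<integral>\<^sup>+x. \<integral>\<^sup>+y. ennreal ((w x - w y)\<^sup>2 / (dist x y)\<^sup>2)
     \<partial>surface_measure \<Gamma> \<partial>surface_measure \<Gamma>)"

definition H_half :: "(real^2) set \<Rightarrow> (real^2 \<Rightarrow> real) set" where
  "H_half \<Gamma> = {w \<in> L2 (surface_measure \<Gamma>). gagliardo \<Gamma> w < \<infinity>}"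

definition H_half_norm :: "(real^2) set \<Rightarrow> (real^2 \<Rightarrow> real) \<Rightarrow> real" where
  "H_half_norm \<Gamma> w = sqrt ((LINT x|surface_measure \<Gamma>. (w x)\<^sup>2) + enn2real (gagliardo \<Gamma> w))"

text \<open>
  The trace operator is the bounded linear operator from \<open>H1 \<Omega>\<close> to \<open>L\<^sup>2\<close> of the boundary
  that extends the restriction of functions smooth up to the boundary. As these are dense in
  \<open>H1 \<Omega>\<close>, this determines the operator (almost everywhere).
\<close>

definition trace_operator ::
  "(real^2) set \<Rightarrow> ((real^2 \<Rightarrow> real) \<Rightarrow> real^2 \<Rightarrow> real) \<Rightarrow> bool" where
  "trace_operator \<Omega> \<gamma> \<longleftrightarrow>
     (\<forall>v\<in>H1 \<Omega>. \<gamma> v \<in> L2 (surface_measure (frontier \<Omega>))) \<and>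
     (\<forall>u\<in>H1 \<Omega>. \<forall>v\<in>H1 \<Omega>. AE x in surface_measure (frontier \<Omega>).
        \<gamma> (\<lambda>y. u y + v y) x = \<gamma> u x + \<gamma> v x) \<and>
     (\<forall>c. \<forall>v\<in>H1 \<Omega>. AE x in surface_measure (frontier \<Omega>). \<gamma> (\<lambda>y. c * v y) x = c * \<gamma> v x) \<and>
     (\<exists>C. \<forall>v\<in>H1 \<Omega>. sqrt (LINT x|surface_measure (frontier \<Omega>). (\<gamma> v x)\<^sup>2) \<le> C * H1_norm \<Omega> v) \<and>
     (\<forall>v. smooth_on UNIV v \<longrightarrow> (AE x in surface_measure (frontier \<Omega>). \<gamma> v x = v x))"

text \<open>The image of a set of functions under the trace operator, closed under a.e. equality.\<close>

definition trace_image :: "(real^2) set \<Rightarrow> ((real^2 \<Rightarrow> real) \<Rightarrow> real^2 \<Rightarrow> real) \<Rightarrow>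
    (real^2 \<Rightarrow> real) set \<Rightarrow> (real^2 \<Rightarrow> real) set" where
  "trace_image \<Omega> \<gamma> V = {w \<in> L2 (surface_measure (frontier \<Omega>)).
     \<exists>v\<in>V. AE x in surface_measure (frontier \<Omega>). \<gamma> v x = w x}"

section \<open>Dual spaces\<close>

text \<open>
  Functionals are extensional, so that equality of two elements of a dual space is HOL equality.
  Boundedness makes them invariant under a.e. equality of representatives.
\<close>

definition dual_space :: "(real^2 \<Rightarrow> real) set \<Rightarrow> ((real^2 \<Rightarrow> real) \<Rightarrow> real) \<Rightarrow>
    ((real^2 \<Rightarrow> real) \<Rightarrow> real) set" where
  "dual_space V N = {F \<in> extensional V.
     (\<forall>u\<in>V. \<forall>v\<in>V. F (\<lambda>x. u x + v x) = F u + F v) \<and>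
     (\<forall>c. \<forall>v\<in>V. F (\<lambda>x. c * v x) = c * F v) \<and>
     (\<exists>C. \<forall>v\<in>V. \<bar>F v\<bar> \<le> C * N v)}"

definition dual_norm :: "(real^2 \<Rightarrow> real) set \<Rightarrow> ((real^2 \<Rightarrow> real) \<Rightarrow> real) \<Rightarrow>
    ((real^2 \<Rightarrow> real) \<Rightarrow> real) \<Rightarrow> real" where
  "dual_norm V N F = (SUP v\<in>{v \<in> V. N v \<le> 1}. \<bar>F v\<bar>)"

definition continuous_dual_operator ::
  "(real^2 \<Rightarrow> real) set \<Rightarrow> ((real^2 \<Rightarrow> real) \<Rightarrow> real) \<Rightarrow>
   (real^2 \<Rightarrow> real) set \<Rightarrow> ((real^2 \<Rightarrow> real) \<Rightarrow> real) \<Rightarrow>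
   (((real^2 \<Rightarrow> real) \<Rightarrow> real) \<Rightarrow> (real^2 \<Rightarrow> real) \<Rightarrow> real) \<Rightarrow> bool" where
  "continuous_dual_operator V N W P T \<longleftrightarrow>
     (\<forall>F\<in>dual_space V N. T F \<in> dual_space W P) \<and>
     (\<forall>F\<in>dual_space V N. \<forall>G\<in>dual_space V N.
        T (\<lambda>v\<in>V. F v + G v) = (\<lambda>w\<in>W. T F w + T G w)) \<and>
     (\<forall>c. \<forall>F\<in>dual_space V N. T (\<lambda>v\<in>V. c * F v) = (\<lambda>w\<in>W. c * T F w)) \<and>
     (\<exists>C. \<forall>F\<in>dual_space V N. dual_norm W P (T F) \<le> C * dual_norm V N F)"

section \<open>The mixed problems\<close>

definition X_space :: "(real^2) set \<Rightarrow> (real^2) set \<Rightarrow> ((real^2 \<Rightarrow> real) \<Rightarrow> real^2 \<Rightarrow> real) \<Rightarrow>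
    (real^2 \<Rightarrow> real) set" where
  "X_space \<Omega> \<Gamma>1 \<gamma> = {v \<in> H1 \<Omega>. AE x in surface_measure \<Gamma>1. \<gamma> v x = 0}"

definition X_norm :: "(real^2) set \<Rightarrow> (real^2 \<Rightarrow> real) \<Rightarrow> real" where
  "X_norm \<Omega> v = sqrt (grad_inner \<Omega> v v)"

definition X_dual :: "(real^2) set \<Rightarrow> (real^2) set \<Rightarrow> ((real^2 \<Rightarrow> real) \<Rightarrow> real^2 \<Rightarrow> real) \<Rightarrow>
    ((real^2 \<Rightarrow> real) \<Rightarrow> real) set" where
  "X_dual \<Omega> \<Gamma>1 \<gamma> = dual_space (X_space \<Omega> \<Gamma>1 \<gamma>) (X_norm \<Omega>)"

definition M_space :: "(real^2) set \<Rightarrow> (real^2) set \<Rightarrow> ((real^2 \<Rightarrow> real) \<Rightarrow> real^2 \<Rightarrow> real) \<Rightarrow>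
    (real^2 \<Rightarrow> real) set" where
  "M_space \<Omega> \<Gamma>1 \<gamma> = trace_image \<Omega> \<gamma> (X_space \<Omega> \<Gamma>1 \<gamma>)"

definition Y_space :: "(real^2) set \<Rightarrow> (real^2) set \<Rightarrow> ((real^2 \<Rightarrow> real) \<Rightarrow> real^2 \<Rightarrow> real) \<Rightarrow>
    ((real^2 \<Rightarrow> real) \<Rightarrow> real) set" where
  "Y_space \<Omega> \<Gamma>1 \<gamma> = dual_space (M_space \<Omega> \<Gamma>1 \<gamma>) (H_half_norm (frontier \<Omega>))"

definition a_form :: "(real^2) set \<Rightarrow> real \<Rightarrow> (real^2 \<Rightarrow> real) \<Rightarrow> (real^2 \<Rightarrow> real) \<Rightarrow> real" where
  "a_form \<Omega> \<xi> u v = \<xi> * grad_inner \<Omega> u v"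

definition Lambda :: "(real^2) set \<Rightarrow> (real^2) set \<Rightarrow> (real^2) set \<Rightarrow>
    ((real^2 \<Rightarrow> real) \<Rightarrow> real^2 \<Rightarrow> real) \<Rightarrow> real \<Rightarrow> ((real^2 \<Rightarrow> real) \<Rightarrow> real) set" where
  "Lambda \<Omega> \<Gamma>1 \<Gamma>3 \<gamma> g = {\<mu> \<in> Y_space \<Omega> \<Gamma>1 \<gamma>.
     \<forall>v\<in>X_space \<Omega> \<Gamma>1 \<gamma>. \<mu> (\<gamma> v) \<le> (LINT x|surface_measure \<Gamma>3. g * \<bar>\<gamma> v x\<bar>)}"

definition Lambda_bar :: "(real^2) set \<Rightarrow> (real^2) set \<Rightarrow> (real^2) set \<Rightarrow>
    ((real^2 \<Rightarrow> real) \<Rightarrow> real^2 \<Rightarrow> real) \<Rightarrow> real \<Rightarrow> ((real^2 \<Rightarrow> real) \<Rightarrow> real) set" where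
  "Lambda_bar \<Omega> \<Gamma>1 \<Gamma>3 \<gamma> g = {\<mu> \<in> X_dual \<Omega> \<Gamma>1 \<gamma>.
     \<forall>v\<in>X_space \<Omega> \<Gamma>1 \<gamma>. \<mu> v \<le> (LINT x|surface_measure \<Gamma>3. g * \<bar>\<gamma> v x\<bar>)}"

definition mixed_solution :: "(real^2) set \<Rightarrow> (real^2) set \<Rightarrow> (real^2) set \<Rightarrow>
    ((real^2 \<Rightarrow> real) \<Rightarrow> real^2 \<Rightarrow> real) \<Rightarrow> real \<Rightarrow> real \<Rightarrow> (real^2 \<Rightarrow> real) \<Rightarrow>
    (real^2 \<Rightarrow> real) \<Rightarrow> ((real^2 \<Rightarrow> real) \<Rightarrow> real) \<Rightarrow> bool" where
  "mixed_solution \<Omega> \<Gamma>1 \<Gamma>3 \<gamma> g \<xi> f u lam \<longleftrightarrow>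
     u \<in> X_space \<Omega> \<Gamma>1 \<gamma> \<and> lam \<in> Lambda \<Omega> \<Gamma>1 \<Gamma>3 \<gamma> g \<and>
     (\<forall>v\<in>X_space \<Omega> \<Gamma>1 \<gamma>. a_form \<Omega> \<xi> u v + lam (\<gamma> v) = grad_inner \<Omega> f v) \<and>
     (\<forall>\<mu>\<in>Lambda \<Omega> \<Gamma>1 \<Gamma>3 \<gamma> g. \<mu> (\<gamma> u) - lam (\<gamma> u) \<le> 0)"

definition mixed_solution_bar :: "(real^2) set \<Rightarrow> (real^2) set \<Rightarrow> (real^2) set \<Rightarrow>
    ((real^2 \<Rightarrow> real) \<Rightarrow> real^2 \<Rightarrow> real) \<Rightarrow> real \<Rightarrow> real \<Rightarrow> (real^2 \<Rightarrow> real) \<Rightarrow>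
    (real^2 \<Rightarrow> real) \<Rightarrow> ((real^2 \<Rightarrow> real) \<Rightarrow> real) \<Rightarrow> bool" where
  "mixed_solution_bar \<Omega> \<Gamma>1 \<Gamma>3 \<gamma> g \<xi> f u lam \<longleftrightarrow>
     u \<in> X_space \<Omega> \<Gamma>1 \<gamma> \<and> lam \<in> Lambda_bar \<Omega> \<Gamma>1 \<Gamma>3 \<gamma> g \<and>
     (\<forall>v\<in>X_space \<Omega> \<Gamma>1 \<gamma>. a_form \<Omega> \<xi> u v + lam v = grad_inner \<Omega> f v) \<and>
     (\<forall>\<mu>\<in>Lambda_bar \<Omega> \<Gamma>1 \<Gamma>3 \<gamma> g. \<mu> u - lam u \<le> 0)"

text \<open>\<open>(u, lam)\<close> satisfies \<open>P\<close>, and is the only such pair (up to a.e. equality on \<open>\<Omega>\<close>).\<close>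

definition unique_solution :: "(real^2) set \<Rightarrow>
    ((real^2 \<Rightarrow> real) \<Rightarrow> ((real^2 \<Rightarrow> real) \<Rightarrow> real) \<Rightarrow> bool) \<Rightarrow>
    (real^2 \<Rightarrow> real) \<Rightarrow> ((real^2 \<Rightarrow> real) \<Rightarrow> real) \<Rightarrow> bool" where
  "unique_solution \<Omega> P u lam \<longleftrightarrow> P u lam \<and>
     (\<forall>u' lam'. P u' lam' \<longrightarrow> (AE x in lebesgue_on \<Omega>. u' x = u x) \<and> lam' = lam)"

end

theory Submission
  imports Defs
begin

text \<open>
  The operator \<open>Bt\<close> is precomposition with the trace: a multiplier \<open>\<mu> \<in> Y\<close>, applied to the
  trace of \<open>v \<in> X\<close>, gives the same number as \<open>Bt \<mu>\<close> applied to \<open>v\<close>. Both mixed problems, and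
  the definitions of their sets of admissible multipliers, see a multiplier only through these
  numbers. Hence \<open>Bt\<close> carries exactly the elements of \<open>Lambda\<close> into \<open>Lambda_bar\<close>
  (\<open>Bt_in_Lambda_bar_iff\<close>), and if \<open>(u, Bt \<mu>)\<close> solves the problem with multipliers in the dual
  of \<open>X\<close>, then \<open>(u, \<mu>)\<close> solves the problem with multipliers in \<open>Y\<close>
  (\<open>mixed_solution_pullback\<close>). Applied to the solution \<open>(ubar, Bt lamtil)\<close>, this shows that
  \<open>(ubar, lamtil)\<close> solves the problem that \<open>(u, lam)\<close> solves uniquely.
\<close>

lemma Bt_in_Lambda_bar_iff:
  assumes dual: "Bt \<mu> \<in> X_dual \<Omega> \<Gamma>1 \<gamma>"
    and adjoint: "\<forall>v\<in>X_space \<Omega> \<Gamma>1 \<gamma>. Bt \<mu> v = \<mu> (\<gamma> v)"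
    and Y: "\<mu> \<in> Y_space \<Omega> \<Gamma>1 \<gamma>"
  shows "Bt \<mu> \<in> Lambda_bar \<Omega> \<Gamma>1 \<Gamma>3 \<gamma> g \<longleftrightarrow> \<mu> \<in> Lambda \<Omega> \<Gamma>1 \<Gamma>3 \<gamma> g"
  using assms by (simp add: Lambda_bar_def Lambda_def)

text \<open>
  The variational inequality on \<open>Lambda\<close> is the one on \<open>Lambda_bar\<close> tested only with the
  functionals \<open>Bt \<nu>\<close> for \<open>\<nu>\<close> in \<open>Lambda\<close>, so it follows from the inclusion of
  \<open>Bt ` Lambda\<close> in \<open>Lambda_bar\<close>.
\<close>

lemma mixed_solution_pullback:
  assumes dual: "\<And>\<nu>. \<nu> \<in> Y_space \<Omega> \<Gamma>1 \<gamma> \<Longrightarrow> Bt \<nu> \<in> X_dual \<Omega> \<Gamma>1 \<gamma>"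
    and adjoint: "\<forall>\<nu>\<in>Y_space \<Omega> \<Gamma>1 \<gamma>. \<forall>v\<in>X_space \<Omega> \<Gamma>1 \<gamma>. Bt \<nu> v = \<nu> (\<gamma> v)"
    and Y: "\<mu> \<in> Y_space \<Omega> \<Gamma>1 \<gamma>"
    and sol: "mixed_solution_bar \<Omega> \<Gamma>1 \<Gamma>3 \<gamma> g \<xi> f u (Bt \<mu>)"
  shows "mixed_solution \<Omega> \<Gamma>1 \<Gamma>3 \<gamma> g \<xi> f u \<mu>"
proof -
  have uX: "u \<in> X_space \<Omega> \<Gamma>1 \<gamma>"
    and bar: "Bt \<mu> \<in> Lambda_bar \<Omega> \<Gamma>1 \<Gamma>3 \<gamma> g"
    and eq: "\<forall>v\<in>X_space \<Omega> \<Gamma>1 \<gamma>. a_form \<Omega> \<xi> u v + Bt \<mu> v = grad_inner \<Omega> f v"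
    and ineq: "\<forall>\<nu>\<in>Lambda_bar \<Omega> \<Gamma>1 \<Gamma>3 \<gamma> g. \<nu> u - Bt \<mu> u \<le> 0"
    using sol by (auto simp: mixed_solution_bar_def)
  have iff: "Bt \<nu> \<in> Lambda_bar \<Omega> \<Gamma>1 \<Gamma>3 \<gamma> g \<longleftrightarrow> \<nu> \<in> Lambda \<Omega> \<Gamma>1 \<Gamma>3 \<gamma> g"
    if "\<nu> \<in> Y_space \<Omega> \<Gamma>1 \<gamma>" for \<nu>
    by (rule Bt_in_Lambda_bar_iff) (use dual adjoint that in auto)
  have "\<nu> (\<gamma> u) - \<mu> (\<gamma> u) \<le> 0" if "\<nu> \<in> Lambda \<Omega> \<Gamma>1 \<Gamma>3 \<gamma> g" for \<nu>
  proof -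
    have "\<nu> \<in> Y_space \<Omega> \<Gamma>1 \<gamma>"
      using that by (simp add: Lambda_def)
    moreover from this have "Bt \<nu> u - Bt \<mu> u \<le> 0"
      using ineq iff that by simp
    ultimately show ?thesis
      using adjoint Y uX by simp
  qed
  moreover have "\<mu> \<in> Lambda \<Omega> \<Gamma>1 \<Gamma>3 \<gamma> g"
    using iff[OF Y] bar by simp
  ultimately show ?thesis
    using uX eq adjoint Y by (simp add: mixed_solution_def)
qed

theorem theorem6:
  fixes \<Omega> \<Gamma>1 \<Gamma>2 \<Gamma>3 :: "(real^2) set"
    and \<gamma> :: "(real^2 \<Rightarrow> real) \<Rightarrow> real^2 \<Rightarrow> real"
    and g \<xi> :: real
    and f0 f2 f u ubar :: "real^2 \<Rightarrow> real"
    and lam lambar lamtil :: "(real^2 \<Rightarrow> real) \<Rightarrow> real"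
    and Bt :: "((real^2 \<Rightarrow> real) \<Rightarrow> real) \<Rightarrow> (real^2 \<Rightarrow> real) \<Rightarrow> real"
  assumes domain: "smooth_bounded_domain \<Omega>"
    and partition: "\<Gamma>1 \<union> \<Gamma>2 \<union> \<Gamma>3 = frontier \<Omega>" "\<Gamma>1 \<inter> \<Gamma>2 = {}" "\<Gamma>1 \<inter> \<Gamma>3 = {}" "\<Gamma>2 \<inter> \<Gamma>3 = {}"
    and measurable: "\<Gamma>1 \<in> sets hausdorff1" "\<Gamma>2 \<in> sets hausdorff1" "\<Gamma>3 \<in> sets hausdorff1"
    and positive: "emeasure hausdorff1 \<Gamma>1 > 0" "emeasure hausdorff1 \<Gamma>2 > 0"
      "emeasure hausdorff1 \<Gamma>3 > 0"
    and constants: "g > 0" "\<xi> > 0"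
    and f0: "f0 \<in> L2 (lebesgue_on \<Omega>)"
    and f2: "f2 \<in> L2 (surface_measure \<Gamma>2)"
    and trace: "trace_operator \<Omega> \<gamma>" "trace_image \<Omega> \<gamma> (H1 \<Omega>) = H_half (frontier \<Omega>)"
    and f: "f \<in> X_space \<Omega> \<Gamma>1 \<gamma>" "\<forall>v\<in>X_space \<Omega> \<Gamma>1 \<gamma>. grad_inner \<Omega> f v =
        (LINT x|lebesgue_on \<Omega>. f0 x * v x) + (LINT x|surface_measure \<Gamma>2. f2 x * \<gamma> v x)"
    and Bt: "continuous_dual_operator (M_space \<Omega> \<Gamma>1 \<gamma>) (H_half_norm (frontier \<Omega>))
        (X_space \<Omega> \<Gamma>1 \<gamma>) (X_norm \<Omega>) Bt"
      "\<forall>\<mu>\<in>Y_space \<Omega> \<Gamma>1 \<gamma>. \<forall>v\<in>X_space \<Omega> \<Gamma>1 \<gamma>. Bt \<mu> v = \<mu> (\<gamma> v)"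
    and sol_bar: "unique_solution \<Omega> (mixed_solution_bar \<Omega> \<Gamma>1 \<Gamma>3 \<gamma> g \<xi> f) ubar lambar"
    and lamtil: "lamtil \<in> Y_space \<Omega> \<Gamma>1 \<gamma>" "Bt lamtil = lambar" "\<forall>\<mu>\<in>Y_space \<Omega> \<Gamma>1 \<gamma>. Bt \<mu> = lambar \<longrightarrow> \<mu> = lamtil"
    and sol: "unique_solution \<Omega> (mixed_solution \<Omega> \<Gamma>1 \<Gamma>3 \<gamma> g \<xi> f) u lam"
  shows "(AE x in lebesgue_on \<Omega>. ubar x = u x) \<and> lamtil = lam"
proof -
  have "Bt \<nu> \<in> X_dual \<Omega> \<Gamma>1 \<gamma>" if "\<nu> \<in> Y_space \<Omega> \<Gamma>1 \<gamma>" for \<nu>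
    using Bt(1) that by (simp add: continuous_dual_operator_def X_dual_def Y_space_def)
  moreover have "mixed_solution_bar \<Omega> \<Gamma>1 \<Gamma>3 \<gamma> g \<xi> f ubar (Bt lamtil)"
    using sol_bar lamtil(2) by (simp add: unique_solution_def)
  ultimately have "mixed_solution \<Omega> \<Gamma>1 \<Gamma>3 \<gamma> g \<xi> f ubar lamtil"
    by (rule mixed_solution_pullback[OF _ Bt(2) lamtil(1)])
  then show ?thesis
    using sol by (simp add: unique_solution_def)
qed

end
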